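(* Let $X=\{X_1,\dots,X_n,\dots\}$ be a stationary process such that the entropy $H(X_1)$ is finite. Then the excess entropy $E$ of $X$ and the mutual information $I_{p-f}$ between the past and the future of $X$ are identical: $$E=I_{p-f}.$$
   Context: A stationary process is a sequence of random variables $X_1,X_2,\dots$ whose joint probability distributions do not change when shifted in time. $H$ denotes Shannon entropy for discrete random variables, $H(X_1,\dots,X_n)=-\sum p(x_1,\dots,x_n)\log p(x_1,\dots,x_n)$ with $p$ the joint probability mass function, and differential entropy for continuous random variables with joint density $f$, $H(X_1,\dots,X_n)=-\int f(x_1,\dots,x_n)\log f(x_1,\dots,x_n)\,dx_1\cdots dx_n$. Put $H(n):=H(X_1,\dots,X_n)$ for $n\ge 1$, $H(0):=0$, and $h(n):=H(n)-H(n-1)$ for $n\ge 1$. The entropy rate of $X$ is $h_\mu:=\lim_{n\to\infty}H(n)/n$. The excess entropy of $X$ is $$E:=\sum_{n=1}^{\infty}(h(n)-h_\mu),$$ where the value $+\infty$ is allowed. The mutual information $I(U;V)$ of two random vectors $U,V$ is the relative entropy between their joint distribution and the product of their marginal distributions (so $I(U;V)=\int\int f(u,v)\log\frac{f(u,v)}{f(u)f(v)}\,du\,dv$ in the case of densities, and the analogous sum in the discrete case); it satisfies $I(U;V)=H(U)+H(V)-H(U,V)$. Put $I_{p-f}(n):=I\big((X_1,\dots,X_n);(X_{n+1},\dots,X_{2n})\big)$. The mutual information between the past and the future is $I_{p-f}:=\lim_{n\to\infty}I_{p-f}(n)$, where the value $+\infty$ is allowed. *)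

theory Defs
  imports "HOL-Probability.Probability"
begin

text \<open>
  The process is \<open>X 1, X 2, \<dots>\<close>; the value \<open>X 0\<close> is never used. All random variables take values in a
  measure space \<open>N\<close>, whose measure is the reference measure for densities: \<open>count_space A\<close> with \<open>A\<close>
  countable for discrete processes (densities are then probability mass functions) and \<open>lborel\<close> for
  continuous real processes. The logarithm has an arbitrary base \<open>b > 1\<close>.
\<close>

definition stationary_process :: "'a measure \<Rightarrow> 'b measure \<Rightarrow> (nat \<Rightarrow> 'a \<Rightarrow> 'b) \<Rightarrow> bool" where
  "stationary_process M N X \<longleftrightarrow>
     prob_space M \<and>
     (\<forall>i\<ge>1. X i \<in> measurable M N) \<and>
     (\<forall>J k. finite J \<and> J \<subseteq> {1..} \<longrightarrow>
        distr M (PiM J (\<lambda>_. N)) (\<lambda>\<omega>. \<lambda>i\<in>J. X (i + k) \<omega>) =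
        distr M (PiM J (\<lambda>_. N)) (\<lambda>\<omega>. \<lambda>i\<in>J. X i \<omega>))"

text \<open>
  The library's \<^const>\<open>KL_divergence\<close>, \<open>mutual_information\<close> and Bochner integral are real-valued
  and yield 0 where the quantity is infinite, so extended real versions are needed.
  As \<open>\<infinity> - \<infinity> = \<infinity>\<close> in \<^typ>\<open>ereal\<close>, the integral below is finite iff the function is integrable.
\<close>

definition ext_integral :: "'a measure \<Rightarrow> ('a \<Rightarrow> real) \<Rightarrow> ereal" where
  "ext_integral M g =
     enn2ereal (\<integral>\<^sup>+x. ennreal (g x) \<partial>M) - enn2ereal (\<integral>\<^sup>+x. ennreal (- g x) \<partial>M)"

text \<open>Entropy of the random variable \<open>Y\<close> relative to the reference measure \<open>S\<close>: minus the integral of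
  \<open>f log f\<close>, where \<open>f\<close> is the density of the law of \<open>Y\<close>.\<close>

definition ext_entropy :: "real \<Rightarrow> 'a measure \<Rightarrow> 'b measure \<Rightarrow> ('a \<Rightarrow> 'b) \<Rightarrow> ereal" where
  "ext_entropy b M S Y =
     ext_integral S (\<lambda>y. let f = enn2real (RN_deriv S (distr M S Y) y) in - (f * log b f))"

text \<open>Relative entropy of \<open>P\<close> with respect to \<open>Q\<close>, with the argument order of \<^const>\<open>KL_divergence\<close>.\<close>

definition ext_KL_divergence :: "real \<Rightarrow> 'a measure \<Rightarrow> 'a measure \<Rightarrow> ereal" where
  "ext_KL_divergence b Q P =
     (if absolutely_continuous Q P then ext_integral P (entropy_density b Q P) else \<infinity>)"

definition ext_mutual_information ::
    "real \<Rightarrow> 'a measure \<Rightarrow> 'b measure \<Rightarrow> 'c measure \<Rightarrow> ('a \<Rightarrow> 'b) \<Rightarrow> ('a \<Rightarrow> 'c) \<Rightarrow> ereal" where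
  "ext_mutual_information b M S T U V =
     ext_KL_divergence b (distr M S U \<Otimes>\<^sub>M distr M T V) (distr M (S \<Otimes>\<^sub>M T) (\<lambda>\<omega>. (U \<omega>, V \<omega>)))"

definition block :: "(nat \<Rightarrow> 'a \<Rightarrow> 'b) \<Rightarrow> nat set \<Rightarrow> 'a \<Rightarrow> nat \<Rightarrow> 'b" where
  "block X J \<omega> = (\<lambda>i\<in>J. X i \<omega>)"

definition block_entropy :: "real \<Rightarrow> 'a measure \<Rightarrow> 'b measure \<Rightarrow> (nat \<Rightarrow> 'a \<Rightarrow> 'b) \<Rightarrow> nat \<Rightarrow> ereal" where
  "block_entropy b M N X n =
     (if n = 0 then 0 else ext_entropy b M (PiM {1..n} (\<lambda>_. N)) (block X {1..n}))"

definition entropy_gain :: "real \<Rightarrow> 'a measure \<Rightarrow> 'b measure \<Rightarrow> (nat \<Rightarrow> 'a \<Rightarrow> 'b) \<Rightarrow> nat \<Rightarrow> ereal" where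
  "entropy_gain b M N X n = block_entropy b M N X n - block_entropy b M N X (n - 1)"

definition entropy_rate :: "real \<Rightarrow> 'a measure \<Rightarrow> 'b measure \<Rightarrow> (nat \<Rightarrow> 'a \<Rightarrow> 'b) \<Rightarrow> ereal" where
  "entropy_rate b M N X = lim (\<lambda>n. block_entropy b M N X n / ereal (real n))"

text \<open>The index of the series is shifted by one. For continuous processes the entropy rate may be
  \<open>-\<infinity>\<close>; then every term of the series is \<open>\<infinity>\<close>, because \<open>x - (-\<infinity>) = \<infinity>\<close> for all \<open>x :: ereal\<close>
  (including \<open>x = -\<infinity>\<close>), and so is the sum.\<close>

definition excess_entropy :: "real \<Rightarrow> 'a measure \<Rightarrow> 'b measure \<Rightarrow> (nat \<Rightarrow> 'a \<Rightarrow> 'b) \<Rightarrow> ereal" where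
  "excess_entropy b M N X = (\<Sum>n. entropy_gain b M N X (Suc n) - entropy_rate b M N X)"

definition past_future_information_upto ::
    "real \<Rightarrow> 'a measure \<Rightarrow> 'b measure \<Rightarrow> (nat \<Rightarrow> 'a \<Rightarrow> 'b) \<Rightarrow> nat \<Rightarrow> ereal" where
  "past_future_information_upto b M N X n =
     ext_mutual_information b M (PiM {1..n} (\<lambda>_. N)) (PiM {n+1..2*n} (\<lambda>_. N))
       (block X {1..n}) (block X {n+1..2*n})"

definition past_future_information ::
    "real \<Rightarrow> 'a measure \<Rightarrow> 'b measure \<Rightarrow> (nat \<Rightarrow> 'a \<Rightarrow> 'b) \<Rightarrow> ereal" where
  "past_future_information b M N X = lim (past_future_information_upto b M N X)"

text \<open>The two special cases of \<^const>\<open>ext_entropy\<close>: differential entropy from any joint density, and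
  Shannon entropy from the joint probability mass function.\<close>

lemma ext_integral_cong_AE:
  assumes "AE x in M. f x = g x"
  shows "ext_integral M f = ext_integral M g"
proof -
  have "(\<integral>\<^sup>+x. ennreal (f x) \<partial>M) = (\<integral>\<^sup>+x. ennreal (g x) \<partial>M)"
    by (rule nn_integral_cong_AE) (use assms in auto)
  moreover have "(\<integral>\<^sup>+x. ennreal (- f x) \<partial>M) = (\<integral>\<^sup>+x. ennreal (- g x) \<partial>M)"
    by (rule nn_integral_cong_AE) (use assms in auto)
  ultimately show ?thesis by (simp add: ext_integral_def zero_ennreal.rep_eq)
qed

lemma ext_entropy_distributed:
  assumes "sigma_finite_measure S" and "distributed M S Y (\<lambda>y. ennreal (f y))" and "\<And>y. f y \<ge> 0"
  shows "ext_entropy b M S Y = ext_integral S (\<lambda>y. - (f y * log b (f y)))"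
proof -
  have "AE y in S. ennreal (f y) = RN_deriv S (distr M S Y) y"
    using assms by (intro sigma_finite_measure.RN_deriv_unique) (auto simp: distributed_def)
  then show ?thesis
    unfolding ext_entropy_def Let_def
    by (intro ext_integral_cong_AE, eventually_elim) (use assms(3) in \<open>metis enn2real_ennreal\<close>)
qed

lemma block_entropy_discrete:
  assumes M: "prob_space M" and A: "countable A" and n: "n \<ge> 1" and b: "b > 1"
    and X: "\<And>i. i \<ge> 1 \<Longrightarrow> X i \<in> measurable M (count_space A)"
  defines "p \<equiv> \<lambda>x. measure M {\<omega> \<in> space M. \<forall>i\<in>{1..n}. X i \<omega> = x i}"
  shows "block_entropy b M (count_space A) X n =
    enn2ereal (\<integral>\<^sup>+x. ennreal (- (p x * log b (p x))) \<partial>count_space (PiE {1..n} (\<lambda>_. A)))"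
proof -
  interpret prob_space M by fact
  let ?C = "count_space (PiE {1..n} (\<lambda>_. A))"
  have C: "PiM {1..n} (\<lambda>_. count_space A) = ?C"
    by (rule count_space_PiM_finite) (use A in auto)
  have cnt: "countable (PiE {1..n} (\<lambda>_. A))" by (intro countable_PiE) (use A in auto)
  have meas: "block X {1..n} \<in> measurable M ?C"
    unfolding C[symmetric] block_def by (intro measurable_restrict X) auto
  have eq: "block X {1..n} -` {x} \<inter> space M = {\<omega> \<in> space M. \<forall>i\<in>{1..n}. X i \<omega> = x i}"
    if "x \<in> PiE {1..n} (\<lambda>_. A)" for x
    using that by (auto simp: block_def fun_eq_iff PiE_def extensional_def)
  have "distr M ?C (block X {1..n}) = density ?C (\<lambda>x. ennreal (p x))"
  proof (rule measure_eqI_countable[OF _ _ cnt])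
    fix x assume x: "x \<in> PiE {1..n} (\<lambda>_. A)"
    have "emeasure (density ?C (\<lambda>x. ennreal (p x))) {x} = ennreal (p x)"
      using x by (subst emeasure_density) (auto simp: nn_integral_count_space_indicator[symmetric]
        nn_integral_indicator_singleton)
    moreover have "emeasure (distr M ?C (block X {1..n})) {x} = ennreal (p x)"
      using x meas by (simp add: emeasure_distr eq[OF x] p_def emeasure_eq_measure del: One_nat_def)
    ultimately show "emeasure (distr M ?C (block X {1..n})) {x} =
        emeasure (density ?C (\<lambda>x. ennreal (p x))) {x}" by simp
  qed auto
  then have d: "distributed M ?C (block X {1..n}) (\<lambda>x. ennreal (p x))"
    using meas by (auto simp: distributed_def)
  have "p x \<ge> 0" for x by (simp add: p_def)
  then have "block_entropy b M (count_space A) X n = ext_integral ?C (\<lambda>x. - (p x * log b (p x)))"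
    using n ext_entropy_distributed[OF sigma_finite_measure_count_space_countable[OF cnt] d]
    by (simp add: block_entropy_def C del: One_nat_def)
  moreover have "p x * log b (p x) \<le> 0" for x
    using b by (cases "p x = 0") (auto simp: p_def mult_le_0_iff zero_less_measure_iff)
  then have "(\<integral>\<^sup>+x. ennreal (- (- (p x * log b (p x)))) \<partial>?C) = 0"
    by (simp add: ennreal_neg)
  ultimately show ?thesis by (simp add: ext_integral_def zero_ennreal.rep_eq)
qed

end

theory Submission
  imports Defs
begin

text \<open>
  Discrete and continuous processes are treated at once: the block laws have densities with respect to
  the powers of a sigma-finite reference measure, and every entropy is the expectation of minus the log
  density \<open>loglik J\<close> of the block \<open>J\<close>, evaluated at the process.

  Everything rests on one inequality. For disjoint blocks \<open>A\<close>, \<open>B\<close>, \<open>C\<close> the ratio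
  \<open>f\<^bsub>AB\<^esub> f\<^bsub>BC\<^esub> / (f\<^bsub>B\<^esub> f\<^bsub>ABC\<^esub>)\<close> has expectation at most 1. As \<open>log v \<le> (v - 1) / ln b\<close>, its logarithm has an
  integrable positive part, and expectation at most 0 if it is integrable: the conditional mutual
  information of \<open>A\<close> and \<open>C\<close> given \<open>B\<close> (abbreviated cmi below) is well defined and nonnegative.

  If all \<open>H(n)\<close> are finite, this makes \<open>H\<close> concave, so \<open>h\<close> decreases to the entropy rate; since
  \<open>I\<^bsub>p-f\<^esub>(n) = 2 H(n) - H(2n)\<close> is the sum of \<open>h(k) - h(n + k)\<close> over \<open>1 \<le> k \<le> n\<close>, it tends to \<open>E\<close>.
  Otherwise let \<open>m\<close> be minimal with \<open>H(m) = -\<infinity>\<close>. Then the entropy rate is \<open>-\<infinity>\<close> and \<open>E = \<infinity>\<close>; moreover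
  the information between \<open>m - 1\<close> past variables and one future variable is
  \<open>H(m - 1) + H(1) - H(m) = \<infinity>\<close>, and by monotonicity of the information \<open>I\<^bsub>p-f\<^esub>(n) = \<infinity>\<close> for \<open>n \<ge> m\<close>.
\<close>

section \<open>Functions with integrable positive part\<close>

text \<open>The expectation of such a function is defined but may be -\<infinity>. The class is
  closed under sums, so entropy inequalities can be handled on the level of integrands while some of
  the entropies may still be infinite.\<close>

definition upper_integrable :: "'a measure \<Rightarrow> ('a \<Rightarrow> real) \<Rightarrow> bool" where
  "upper_integrable M g \<longleftrightarrow> g \<in> borel_measurable M \<and> (\<integral>\<^sup>+x. ennreal (g x) \<partial>M) < \<infinity>"

lemma upper_integrable_add:
  assumes "upper_integrable M f" "upper_integrable M g"
  shows "upper_integrable M (\<lambda>x. f x + g x)"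
proof -
  have [measurable]: "f \<in> borel_measurable M" "g \<in> borel_measurable M"
    using assms by (auto simp: upper_integrable_def)
  have le: "ennreal (f x + g x) \<le> ennreal (f x) + ennreal (g x)" for x
  proof -
    have "ennreal (f x + g x) \<le> ennreal (max 0 (f x) + max 0 (g x))"
      by (intro ennreal_leI) auto
    also have "\<dots> = ennreal (f x) + ennreal (g x)"
      by (simp add: ennreal_plus max_def ennreal_neg)
    finally show ?thesis .
  qed
  have "(\<integral>\<^sup>+x. ennreal (f x + g x) \<partial>M) \<le> (\<integral>\<^sup>+x. ennreal (f x) + ennreal (g x) \<partial>M)"
    by (intro nn_integral_mono le)
  also have "\<dots> = (\<integral>\<^sup>+x. ennreal (f x) \<partial>M) + (\<integral>\<^sup>+x. ennreal (g x) \<partial>M)"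
    by (intro nn_integral_add) auto
  also have "\<dots> < \<infinity>" using assms by (auto simp: upper_integrable_def)
  finally show ?thesis by (auto simp: upper_integrable_def)
qed

lemma upper_integrable_cong_AE:
  assumes "upper_integrable M f" "AE x in M. f x = g x" "g \<in> borel_measurable M"
  shows "upper_integrable M g"
proof -
  have "(\<integral>\<^sup>+x. ennreal (f x) \<partial>M) = (\<integral>\<^sup>+x. ennreal (g x) \<partial>M)"
    by (rule nn_integral_cong_AE) (use assms(2) in auto)
  with assms show ?thesis by (auto simp: upper_integrable_def)
qed

lemma integrable_iff_upper_integrable:
  "integrable M g \<longleftrightarrow> upper_integrable M g \<and> upper_integrable M (\<lambda>x. - g x)"
  by (auto simp: real_integrable_def upper_integrable_def less_top)

lemma ext_integral_eq_integral:
  assumes "integrable M g"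
  shows "ext_integral M g = ereal (integral\<^sup>L M g)"
proof -
  have "(\<integral>\<^sup>+x. ennreal (g x) \<partial>M) \<noteq> \<infinity>" "(\<integral>\<^sup>+x. ennreal (- g x) \<partial>M) \<noteq> \<infinity>"
    using assms by (auto simp: real_integrable_def)
  then show ?thesis
    unfolding ext_integral_def real_lebesgue_integral_def[OF assms]
    by (cases "\<integral>\<^sup>+x. ennreal (g x) \<partial>M"; cases "\<integral>\<^sup>+x. ennreal (- g x) \<partial>M")
       (auto simp: enn2ereal_ennreal)
qed

text \<open>As \<infinity> - \<infinity> = \<infinity>, an infinite positive part would force the
  value \<infinity>. So the positive part is finite, and then the negative part is finite
  too.\<close>

lemma ext_integral_finite_imp_integrable:
  assumes "g \<in> borel_measurable M" "\<bar>ext_integral M g\<bar> \<noteq> \<infinity>"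
  shows "integrable M g"
proof -
  have "(\<integral>\<^sup>+x. ennreal (g x) \<partial>M) \<noteq> \<infinity>"
    using assms(2) by (auto simp: ext_integral_def)
  moreover from this have "(\<integral>\<^sup>+x. ennreal (- g x) \<partial>M) \<noteq> \<infinity>"
    using assms(2)
    by (cases "\<integral>\<^sup>+x. ennreal (g x) \<partial>M") (auto simp: ext_integral_def enn2ereal_ennreal)
  ultimately show ?thesis using assms(1) by (auto simp: real_integrable_def)
qed

lemma ext_integral_eq_MInf:
  assumes "upper_integrable M g" "\<not> integrable M g"
  shows "ext_integral M g = -\<infinity>"
proof -
  have "(\<integral>\<^sup>+x. ennreal (g x) \<partial>M) \<noteq> \<infinity>" "(\<integral>\<^sup>+x. ennreal (- g x) \<partial>M) = \<infinity>"
    using assms by (auto simp: real_integrable_def upper_integrable_def)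
  then show ?thesis
    by (cases "\<integral>\<^sup>+x. ennreal (g x) \<partial>M") (auto simp: ext_integral_def enn2ereal_ennreal)
qed

lemma ext_integral_eq_PInf:
  assumes "g \<in> borel_measurable M" "\<not> upper_integrable M g"
  shows "ext_integral M g = \<infinity>"
proof -
  have "(\<integral>\<^sup>+x. ennreal (g x) \<partial>M) = \<infinity>"
    using assms by (simp add: upper_integrable_def not_less top_unique)
  then show ?thesis by (simp add: ext_integral_def)
qed

lemma ext_integral_cong:
  assumes "\<And>x. x \<in> space M \<Longrightarrow> f x = g x"
  shows "ext_integral M f = ext_integral M g"
  by (rule ext_integral_cong_AE) (use assms in auto)

lemma ext_integral_distr:
  assumes "f \<in> measurable M N" "g \<in> borel_measurable N"
  shows "ext_integral (distr M N f) g = ext_integral M (\<lambda>x. g (f x))"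
  using assms by (simp add: ext_integral_def nn_integral_distr)

lemma upper_integrable_log:
  fixes b :: real
  assumes b: "b > 1" and v: "v \<in> borel_measurable M" "AE x in M. v x > 0"
    and int: "(\<integral>\<^sup>+x. ennreal (v x) \<partial>M) \<le> 1"
  shows "upper_integrable M (\<lambda>x. log b (v x))"
proof -
  have [measurable]: "v \<in> borel_measurable M" by fact
  have "(\<integral>\<^sup>+x. ennreal (log b (v x)) \<partial>M) \<le> (\<integral>\<^sup>+x. ennreal (1 / ln b) * ennreal (v x) \<partial>M)"
  proof (rule nn_integral_mono_AE, use v(2) in eventually_elim)
    fix x assume "v x > 0"
    \<comment> \<open>The bound \<open>v / ln b\<close> is weaker than
      \<open>(v - 1) / ln b\<close>, but nonnegative, so that \<open>ennreal\<close> does not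
      truncate it.\<close>
    then have "log b (v x) \<le> 1 / ln b * v x"
      using b ln_le_minus_one[of "v x"] by (simp add: log_def divide_right_mono)
    then show "ennreal (log b (v x)) \<le> ennreal (1 / ln b) * ennreal (v x)"
      using b \<open>v x > 0\<close> by (subst ennreal_mult[symmetric]) (auto intro!: ennreal_leI)
  qed
  also have "\<dots> = ennreal (1 / ln b) * (\<integral>\<^sup>+x. ennreal (v x) \<partial>M)"
    by (rule nn_integral_cmult) auto
  also have "\<dots> \<le> ennreal (1 / ln b) * 1" by (intro mult_left_mono int) auto
  also have "\<dots> < \<infinity>" by simp
  finally show ?thesis by (simp add: upper_integrable_def)
qed

text \<open>Jensen's inequality for the logarithm by way of its tangent at 1: the mean of
  \<open>(v - 1) / ln b\<close> is at most 0.\<close>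

lemma (in prob_space) expectation_log_nonpos:
  fixes b :: real
  assumes b: "b > 1" and v: "v \<in> borel_measurable M" "AE x in M. v x > 0"
    and int: "(\<integral>\<^sup>+x. ennreal (v x) \<partial>M) \<le> 1" and log: "integrable M (\<lambda>x. log b (v x))"
  shows "expectation (\<lambda>x. log b (v x)) \<le> 0"
proof -
  have fin: "(\<integral>\<^sup>+x. ennreal (v x) \<partial>M) < \<infinity>" using int by (rule le_less_trans) auto
  have v_int: "integrable M v"
    using v fin by (intro integrableI_nonneg) (auto elim: eventually_mono)
  have v_le: "expectation v \<le> 1"
  proof -
    have "ennreal (expectation v) \<le> 1"
      using v int v_int by (subst nn_integral_eq_integral[symmetric]) (auto elim: eventually_mono)
    then show ?thesis by (simp add: ennreal_le_1)
  qed
  have "expectation (\<lambda>x. log b (v x)) \<le> expectation (\<lambda>x. (v x - 1) / ln b)"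
  proof (rule integral_mono_AE[OF log])
    show "AE x in M. log b (v x) \<le> (v x - 1) / ln b"
      using v(2)
    proof eventually_elim
      fix x assume "v x > 0"
      then show "log b (v x) \<le> (v x - 1) / ln b"
        using b ln_le_minus_one[of "v x"] by (simp add: log_def divide_right_mono)
    qed
  qed (use v_int in auto)
  also have "\<dots> = (expectation v - 1) / ln b" using v_int by (simp add: prob_space)
  also have "\<dots> \<le> 0" using v_le b by (simp add: divide_le_0_iff)
  finally show ?thesis .
qed

section \<open>Concave sequences\<close>

locale concave_sequence =
  fixes a :: "nat \<Rightarrow> real"
  assumes zero: "a 0 = 0" and concave: "\<And>n. a (Suc (Suc n)) + a n \<le> 2 * a (Suc n)"
begin

text \<open>If \<open>a n\<close> is the block entropy \<open>H(n)\<close>, then \<open>h n\<close> is the paper's \<open>h(n + 1)\<close>.\<close>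

definition h :: "nat \<Rightarrow> real" where "h n = a (Suc n) - a n"

lemma decseq_h: "decseq h"
  by (rule decseq_SucI) (use concave in \<open>simp add: h_def algebra_simps\<close>)

lemma sum_h: "(\<Sum>k<n. h k) = a n"
  by (simp add: h_def sum_lessThan_telescope zero)

text \<open>The infimum is taken in \<open>ereal\<close> because the entropy rate may be
  -\<infinity> even though all values of \<open>a\<close> are finite.\<close>

definition h_lim :: ereal where "h_lim = (INF n. ereal (h n))"

lemma h_lim_le: "h_lim \<le> ereal (h n)"
  unfolding h_lim_def by (rule INF_lower) simp

lemma tendsto_h: "(\<lambda>n. ereal (h n)) \<longlonglongrightarrow> h_lim"
  unfolding h_lim_def by (rule LIMSEQ_INF) (use decseq_h in \<open>simp add: decseq_def\<close>)

text \<open>\<open>a n\<close> is a sum of \<open>n\<close> increments, each at least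
  \<open>h n\<close>.\<close>

lemma h_le_average: "real n * h n \<le> a n"
proof -
  have "(\<Sum>k<n. h n) \<le> (\<Sum>k<n. h k)"
    by (rule sum_mono) (use decseq_h in \<open>auto simp: decseq_def\<close>)
  then show ?thesis by (simp add: sum_h)
qed

lemma average_le: "a (m + d) \<le> a m + real d * h m"
proof (induction d)
  case (Suc d)
  have "a (m + Suc d) = a (m + d) + h (m + d)" by (simp add: h_def)
  also have "h (m + d) \<le> h m" using decseq_h by (simp add: decseq_def)
  finally show ?case using Suc by (simp add: algebra_simps)
qed simp

text \<open>Cesaro means of the decreasing sequence \<open>h\<close>, including the limit
  -\<infinity>: \<open>h_le_average\<close> gives the lower bound, \<open>average_le\<close> at a
  fixed \<open>m\<close> the upper one.\<close>

lemma tendsto_average: "(\<lambda>n. ereal (a n) / ereal (real n)) \<longlonglongrightarrow> h_lim"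
proof (rule order_tendstoI)
  fix x assume "x < h_lim"
  show "\<forall>\<^sub>F n in sequentially. x < ereal (a n) / ereal (real n)"
    using eventually_gt_at_top[of 0]
  proof eventually_elim
    fix n :: nat assume "n > 0"
    then have "h n \<le> a n / real n" using h_le_average[of n] by (simp add: field_simps)
    then have "ereal (h n) \<le> ereal (a n) / ereal (real n)" using \<open>n > 0\<close> by simp
    then show "x < ereal (a n) / ereal (real n)"
      using h_lim_le[of n] \<open>x < h_lim\<close> by (meson less_le_trans)
  qed
next
  fix x assume "h_lim < x"
  then obtain m where "ereal (h m) < x" by (auto simp: h_lim_def INF_less_iff)
  then obtain y where y: "h m < y" "ereal y < x"
    using ereal_dense2[of "ereal (h m)" x] by auto
  \<comment> \<open>This is the right side of \<open>average_le\<close> with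
    \<open>d = n - m\<close>, divided by \<open>n\<close>. It tends to \<open>h m\<close> and is
    therefore eventually below \<open>y\<close>.\<close>
  have "(\<lambda>n. a m * (1 / real n) + (1 - real m * (1 / real n)) * h m) \<longlonglongrightarrow> a m * 0 + (1 - real m * 0) * h m"
    by (intro tendsto_intros lim_1_over_n)
  then have "\<forall>\<^sub>F n in sequentially. a m * (1 / real n) + (1 - real m * (1 / real n)) * h m < y"
    using y(1) by (intro order_tendstoD(2)) auto
  then show "\<forall>\<^sub>F n in sequentially. ereal (a n) / ereal (real n) < x"
    using eventually_gt_at_top[of 0] eventually_ge_at_top[of m]
  proof eventually_elim
    fix n :: nat assume n: "n > 0" "m \<le> n"
      and lt: "a m * (1 / real n) + (1 - real m * (1 / real n)) * h m < y"
    have "a n \<le> a m + (real n - real m) * h m"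
      using average_le[of m "n - m"] n by (simp add: of_nat_diff)
    then have "a n / real n \<le> (a m + (real n - real m) * h m) / real n"
      by (rule divide_right_mono) simp
    also have "\<dots> = a m * (1 / real n) + (1 - real m * (1 / real n)) * h m"
      using n by (simp add: field_simps)
    finally have "a n / real n < y" using lt by simp
    then have "ereal (a n) / ereal (real n) < ereal y" using n by simp
    then show "ereal (a n) / ereal (real n) < x" using y(2) by (rule less_trans)
  qed
qed

lemma sum_h_diff: "2 * a n - a (2 * n) = (\<Sum>k<n. h k - h (n + k))"
proof -
  have "(\<Sum>k<n. h (n + k)) = a (n + n) - a n"
    using sum_lessThan_telescope[of "\<lambda>k. a (n + k)" n] by (simp add: h_def)
  then show ?thesis by (simp add: sum_subtractf sum_h flip: mult_2)
qed

text \<open>All terms \<open>h k - h (n + k)\<close> are nonnegative, so those with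
  \<open>k \<ge> m\<close> may be dropped; in the others \<open>h (n + k) \<le> h n\<close>. For
  fixed \<open>m\<close> the variable \<open>n\<close> enters the left side only through
  \<open>h n\<close>, which makes its limit accessible.\<close>

lemma sum_h_diff_ge:
  assumes "m \<le> n"
  shows "(\<Sum>k<m. h k - h n) \<le> 2 * a n - a (2 * n)"
proof -
  have "(\<Sum>k<m. h k - h n) \<le> (\<Sum>k<m. h k - h (n + k))"
    by (rule sum_mono) (use decseq_h in \<open>auto simp: decseq_def\<close>)
  also have "\<dots> \<le> (\<Sum>k<n. h k - h (n + k))"
    by (rule sum_mono2) (use assms decseq_h in \<open>auto simp: decseq_def\<close>)
  finally show ?thesis by (simp only: sum_h_diff)
qed

text \<open>If \<open>h\<close> tends to a real \<open>c\<close>, partial sums of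
  \<open>h k - c\<close> bound the sequence from above, and \<open>sum_h_diff_ge\<close> at a fixed
  \<open>m\<close> yields the \<open>m\<close>-th partial sum as a lower bound in the limit. If
  \<open>h\<close> tends to -\<infinity>, every term of the series is \<infinity>.\<close>

lemma tendsto_excess:
  "(\<lambda>n. ereal (2 * a n - a (2 * n))) \<longlonglongrightarrow> (\<Sum>n. ereal (h n) - h_lim)"
proof (cases h_lim)
  case (real c)
  have h_ge: "c \<le> h n" for n using h_lim_le[of n] real by simp
  have tendsto_c: "h \<longlonglongrightarrow> c" using tendsto_h real by simp
  let ?E = "\<Sum>n. ereal (h n - c)"
  have E: "?E = (SUP m. ereal (\<Sum>k<m. h k - c))"
    using h_ge by (subst suminf_ereal_eq_SUP) auto
  have "(\<lambda>n. ereal (2 * a n - a (2 * n))) \<longlonglongrightarrow> ?E"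
  proof (rule order_tendstoI)
    fix x assume "x < ?E"
    then obtain m where m: "x < ereal (\<Sum>k<m. h k - c)" by (auto simp: E less_SUP_iff)
    have "(\<lambda>n. ereal (\<Sum>k<m. h k - h n)) \<longlonglongrightarrow> ereal (\<Sum>k<m. h k - c)"
      by (intro tendsto_intros tendsto_c)
    then have "\<forall>\<^sub>F n in sequentially. x < ereal (\<Sum>k<m. h k - h n)"
      using m by (rule order_tendstoD)
    then show "\<forall>\<^sub>F n in sequentially. x < ereal (2 * a n - a (2 * n))"
      using eventually_ge_at_top[of m]
      by eventually_elim (erule less_le_trans, simp add: sum_h_diff_ge)
  next
    fix x assume "?E < x"
    have "ereal (2 * a n - a (2 * n)) \<le> ?E" for n
    proof -
      have "2 * a n - a (2 * n) \<le> (\<Sum>k<n. h k - c)"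
        unfolding sum_h_diff by (rule sum_mono) (use h_ge in auto)
      then show ?thesis unfolding E by (intro SUP_upper2[of n]) auto
    qed
    then show "\<forall>\<^sub>F n in sequentially. ereal (2 * a n - a (2 * n)) < x"
      using \<open>?E < x\<close> by (intro always_eventually allI) (rule le_less_trans)
  qed
  then show ?thesis by (simp add: real)
next
  case PInf
  then show ?thesis using h_lim_le[of 0] by simp
next
  case MInf
  have "(\<Sum>n. ereal (h n) - h_lim) = (SUP n::nat. \<Sum>k<n. \<infinity>)"
    using MInf by (subst suminf_ereal_eq_SUP) auto
  also have "\<dots> = \<infinity>"
    by (intro antisym SUP_upper2[of 1]) auto
  finally have E: "(\<Sum>n. ereal (h n) - h_lim) = \<infinity>" .
  show ?thesis unfolding E
  proof (rule order_tendstoI)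
    fix x :: ereal assume "x < \<infinity>"
    then obtain r where r: "x < ereal r" using ereal_dense2 by blast
    have "\<forall>\<^sub>F n in sequentially. ereal (h n) < ereal (h 0 - r)"
      using tendsto_h MInf by (intro order_tendstoD(2)) auto
    then show "\<forall>\<^sub>F n in sequentially. x < ereal (2 * a n - a (2 * n))"
      using eventually_ge_at_top[of 1]
    proof eventually_elim
      fix n assume "ereal (h n) < ereal (h 0 - r)" "1 \<le> n"
      \<comment> \<open>The single difference \<open>h 0 - h n\<close>, the case
        \<open>m = 1\<close>, already exceeds \<open>r\<close>.\<close>
      then have "r \<le> 2 * a n - a (2 * n)" using sum_h_diff_ge[of 1 n] by simp
      with r show "x < ereal (2 * a n - a (2 * n))" by (meson ereal_less_eq(3) less_le_trans)
    qed
  qed simp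
qed

end

section \<open>Block densities\<close>

text \<open>Densities are required of the prefixes; those of all other blocks follow by integrating
  coordinates out (\<open>distributed_dens\<close>). General finite index sets occur because the
  argument uses shifted blocks and parts of blocks.\<close>

locale density_process = prob_space M
  for M :: "'a measure" and N :: "'b measure" and X :: "nat \<Rightarrow> 'a \<Rightarrow> 'b" and b :: real +
  assumes sigma_finite_N: "sigma_finite_measure N" and b: "b > 1"
    and stationary: "stationary_process M N X"
    and distributed_prefix:
      "\<And>n. n \<ge> 1 \<Longrightarrow> \<exists>f. distributed M (PiM {1..n} (\<lambda>_. N)) (block X {1..n}) f"
begin

sublocale P: product_sigma_finite "\<lambda>_::nat. N"
  using sigma_finite_N by (simp add: product_sigma_finite_def)

abbreviation NJ :: "nat set \<Rightarrow> (nat \<Rightarrow> 'b) measure" where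
  "NJ J \<equiv> PiM J (\<lambda>_. N)"

abbreviation index_set :: "nat set \<Rightarrow> bool" where
  "index_set J \<equiv> finite J \<and> J \<subseteq> {1..}"

lemma measurable_X: "i \<ge> 1 \<Longrightarrow> X i \<in> measurable M N"
  using stationary unfolding stationary_process_def by blast

lemma measurable_block [measurable]:
  assumes "index_set J" shows "block X J \<in> measurable M (NJ J)"
proof -
  have "(\<lambda>\<omega>. \<lambda>i\<in>J. X i \<omega>) \<in> measurable M (NJ J)"
    using assms by (intro measurable_restrict measurable_X) auto
  then show ?thesis by (simp add: block_def[abs_def])
qed

lemma restrict_block: "J \<subseteq> K \<Longrightarrow> restrict (block X K \<omega>) J = block X J \<omega>"
  by (auto simp: block_def fun_eq_iff)

lemma merge_block: "merge J K (block X J \<omega>, block X K \<omega>) = block X (J \<union> K) \<omega>"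
  by (auto simp: block_def merge_def fun_eq_iff)

text \<open>Tonelli's theorem, with a factor that depends only on the coordinates in
  \<open>B\<close> taken out of the inner integral.\<close>

lemma nn_integral_fold_restrict:
  assumes "finite A" "finite B" "B \<inter> A = {}"
    and [measurable]: "f \<in> borel_measurable (NJ (B \<union> A))" "g \<in> borel_measurable (NJ B)"
  shows "(\<integral>\<^sup>+y. f y * g (restrict y B) \<partial>NJ (B \<union> A)) =
    (\<integral>\<^sup>+y. (\<integral>\<^sup>+x. f (merge B A (y, x)) \<partial>NJ A) * g y \<partial>NJ B)"
proof -
  have [measurable]: "(\<lambda>y. restrict y B) \<in> measurable (NJ (B \<union> A)) (NJ B)"
    by (intro measurable_restrict_subset) auto
  have "(\<integral>\<^sup>+y. f y * g (restrict y B) \<partial>NJ (B \<union> A)) =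
    (\<integral>\<^sup>+y. (\<integral>\<^sup>+x. f (merge B A (y, x)) * g (restrict (merge B A (y, x)) B) \<partial>NJ A) \<partial>NJ B)"
    by (intro P.product_nn_integral_fold assms) measurable
  also have "\<dots> = (\<integral>\<^sup>+y. (\<integral>\<^sup>+x. f (merge B A (y, x)) * g y \<partial>NJ A) \<partial>NJ B)"
    by (intro nn_integral_cong) (simp add: space_PiM PiE_restrict restrict_merge assms)
  also have "\<dots> = (\<integral>\<^sup>+y. (\<integral>\<^sup>+x. f (merge B A (y, x)) \<partial>NJ A) * g y \<partial>NJ B)"
    by (intro nn_integral_cong nn_integral_multc) measurable
  finally show ?thesis .
qed

text \<open>This is \<open>nn_integral_fold_restrict\<close> with the indicator of an event on the
  coordinates in \<open>B\<close> as \<open>g\<close>.\<close>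

lemma distributed_marginal:
  assumes "index_set A" "index_set B" "B \<inter> A = {}"
    and f: "distributed M (NJ (B \<union> A)) (block X (B \<union> A)) f"
  shows "distributed M (NJ B) (block X B) (\<lambda>y. \<integral>\<^sup>+x. f (merge B A (y, x)) \<partial>NJ A)"
proof -
  interpret A: sigma_finite_measure "NJ A" by (rule P.sigma_finite) (use assms in auto)
  have [measurable]: "f \<in> borel_measurable (NJ (B \<union> A))"
    using f by (rule distributed_borel_measurable)
  have [measurable]: "(\<lambda>y. restrict y B) \<in> measurable (NJ (B \<union> A)) (NJ B)"
    by (intro measurable_restrict_subset) auto
  have meas[measurable]: "block X B \<in> measurable M (NJ B)" using assms by auto
  have "distr M (NJ B) (block X B) = density (NJ B) (\<lambda>y. \<integral>\<^sup>+x. f (merge B A (y, x)) \<partial>NJ A)"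
  proof (rule measure_eqI)
    fix E assume "E \<in> sets (distr M (NJ B) (block X B))"
    then have [measurable]: "E \<in> sets (NJ B)" by simp
    have "emeasure (density (NJ B) (\<lambda>y. \<integral>\<^sup>+x. f (merge B A (y, x)) \<partial>NJ A)) E =
      (\<integral>\<^sup>+y. (\<integral>\<^sup>+x. f (merge B A (y, x)) \<partial>NJ A) * indicator E y \<partial>NJ B)"
      by (subst emeasure_density) auto
    also have "\<dots> = (\<integral>\<^sup>+y. f y * indicator E (restrict y B) \<partial>NJ (B \<union> A))"
      using assms by (intro nn_integral_fold_restrict[symmetric]) auto
    also have "\<dots> = (\<integral>\<^sup>+\<omega>. indicator E (restrict (block X (B \<union> A) \<omega>) B) \<partial>M)"
      by (rule distributed_nn_integral[OF f]) measurable
    also have "\<dots> = (\<integral>\<^sup>+\<omega>. indicator E (block X B \<omega>) \<partial>M)"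
      by (simp add: restrict_block)
    also have "\<dots> = emeasure (distr M (NJ B) (block X B)) E"
      by (subst nn_integral_distr[symmetric, where M' = "NJ B"]) auto
    finally show "emeasure (distr M (NJ B) (block X B)) E =
      emeasure (density (NJ B) (\<lambda>y. \<integral>\<^sup>+x. f (merge B A (y, x)) \<partial>NJ A)) E" ..
  qed simp
  then show ?thesis by (simp add: distributed_def meas)
qed

section \<open>Canonical block densities and log likelihoods\<close>

definition dens :: "nat set \<Rightarrow> (nat \<Rightarrow> 'b) \<Rightarrow> real" where
  "dens J y = enn2real (RN_deriv (NJ J) (distr M (NJ J) (block X J)) y)"

lemma dens_nonneg [simp]: "0 \<le> dens J y"
  by (simp add: dens_def)

lemma measurable_dens [measurable]: "dens J \<in> borel_measurable (NJ J)"
  unfolding dens_def by measurable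

text \<open>\<open>dens\<close> is the version of the density used in \<open>ext_entropy\<close>.
  Radon-Nikodym derivatives are unique almost everywhere, and this one is finite almost everywhere,
  so \<open>enn2real\<close> loses nothing.\<close>

lemma AE_dens_eq:
  assumes "index_set J" and f: "distributed M (NJ J) (block X J) f"
  shows "AE y in NJ J. f y = ennreal (dens J y)"
proof -
  interpret J: sigma_finite_measure "NJ J" by (rule P.sigma_finite) (use assms in auto)
  interpret D: prob_space "distr M (NJ J) (block X J)"
    by (rule prob_space_distr) (use assms in auto)
  have d: "density (NJ J) f = distr M (NJ J) (block X J)" and fm: "f \<in> borel_measurable (NJ J)"
    using f by (auto simp: distributed_def)
  have "AE y in NJ J. RN_deriv (NJ J) (distr M (NJ J) (block X J)) y \<noteq> \<infinity>"
    by (rule J.RN_deriv_finite) (use d fm in \<open>auto intro: absolutely_continuousI_density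
      simp flip: d intro: D.sigma_finite_measure_axioms[folded d]\<close>)
  with J.RN_deriv_unique[OF fm d] show ?thesis
    by eventually_elim (auto simp: dens_def less_top)
qed

lemma distributed_dens:
  assumes "index_set J"
  shows "distributed M (NJ J) (block X J) (\<lambda>y. ennreal (dens J y))"
proof -
  \<comment> \<open>A nonempty prefix that contains \<open>J\<close>; inserting 0 gives
    \<open>Max\<close> a meaning if \<open>J\<close> is empty.\<close>
  define n where "n = Suc (Max (insert 0 J))"
  let ?A = "{1..n} - J"
  have "J \<subseteq> {1..n}"
    using assms by (force simp: n_def le_Suc_eq)
  then have eq: "J \<union> ?A = {1..n}" by auto
  obtain f where "distributed M (NJ (J \<union> ?A)) (block X (J \<union> ?A)) f"
    unfolding eq using distributed_prefix[of n] by (auto simp: n_def)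
  then have f: "distributed M (NJ J) (block X J) (\<lambda>y. \<integral>\<^sup>+x. f (merge J ?A (y, x)) \<partial>NJ ?A)"
    using assms by (intro distributed_marginal) auto
  from AE_dens_eq[OF assms f] have "distributed M (NJ J) (block X J) (\<lambda>y. ennreal (dens J y)) \<longleftrightarrow>
    distributed M (NJ J) (block X J) (\<lambda>y. \<integral>\<^sup>+x. f (merge J ?A (y, x)) \<partial>NJ ?A)"
    using f by (intro distributed_cong_density) (auto elim: eventually_mono simp: distributed_def)
  with f show ?thesis by simp
qed

text \<open>The law of a block has a density, so null sets of the reference measure are null for the
  law.\<close>

lemma AE_block:
  assumes J: "index_set J" and "AE y in NJ J. Q y"
  shows "AE \<omega> in M. Q (block X J \<omega>)"
proof (rule AE_distrD[where f = "block X J" and M' = "NJ J" and P = Q])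
  show "block X J \<in> measurable M (NJ J)" using J by auto
  have law: "distr M (NJ J) (block X J) = density (NJ J) (\<lambda>y. ennreal (dens J y))"
    using distributed_dens[OF J] by (auto simp: distributed_def)
  show "AE y in distr M (NJ J) (block X J). Q y"
    unfolding law by (subst AE_density) (use assms(2) in \<open>auto elim: eventually_mono\<close>)
qed

abbreviation W :: "nat set \<Rightarrow> 'a \<Rightarrow> real" where
  "W J \<omega> \<equiv> dens J (block X J \<omega>)"

definition loglik :: "nat set \<Rightarrow> 'a \<Rightarrow> real" where
  "loglik J \<omega> = log b (W J \<omega>)"

lemma measurable_W [measurable]: "index_set J \<Longrightarrow> W J \<in> borel_measurable M"
  by measurable

lemma measurable_loglik [measurable]: "index_set J \<Longrightarrow> loglik J \<in> borel_measurable M"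
  unfolding loglik_def by measurable

text \<open>A law gives no mass to the zero set of its density. Hence the rules for logarithms of
  products and quotients apply almost surely along the process.\<close>

lemma AE_W_pos:
  assumes J: "index_set J"
  shows "AE \<omega> in M. 0 < W J \<omega>"
proof (rule AE_distrD[where f = "block X J" and M' = "NJ J" and P = "\<lambda>y. 0 < dens J y"])
  show "block X J \<in> measurable M (NJ J)" using J by auto
  have law: "distr M (NJ J) (block X J) = density (NJ J) (\<lambda>y. ennreal (dens J y))"
    using distributed_dens[OF J] by (auto simp: distributed_def)
  show "AE y in distr M (NJ J) (block X J). 0 < dens J y"
    unfolding law by (subst AE_density) auto
qed

lemma ext_entropy_eq:
  assumes J: "index_set J"
  shows "ext_entropy b M (NJ J) (block X J) = ext_integral M (\<lambda>\<omega>. - loglik J \<omega>)"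
proof -
  have "ext_entropy b M (NJ J) (block X J) = ext_integral (NJ J) (\<lambda>y. - (dens J y * log b (dens J y)))"
    by (simp add: ext_entropy_def dens_def Let_def)
  also have "\<dots> = ext_integral M (\<lambda>\<omega>. - loglik J \<omega>)"
  proof -
    \<comment> \<open>The choices \<open>s = -1\<close> and \<open>s = 1\<close> give the positive
      and the negative part of the entropy integral.\<close>
    have "(\<integral>\<^sup>+y. ennreal (s * (dens J y * log b (dens J y))) \<partial>NJ J) = (\<integral>\<^sup>+\<omega>. ennreal (s * loglik J \<omega>) \<partial>M)" for s
    proof -
      have "(\<integral>\<^sup>+y. ennreal (s * (dens J y * log b (dens J y))) \<partial>NJ J) =
        (\<integral>\<^sup>+y. ennreal (dens J y) * ennreal (s * log b (dens J y)) \<partial>NJ J)"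
        by (intro nn_integral_cong) (simp add: ennreal_mult'[symmetric] ac_simps)
      also have "\<dots> = (\<integral>\<^sup>+\<omega>. ennreal (s * loglik J \<omega>) \<partial>M)"
        unfolding loglik_def by (rule distributed_nn_integral[OF distributed_dens[OF J]]) measurable
      finally show ?thesis .
    qed
    from this[of 1] this[of "-1"] show ?thesis by (simp add: ext_integral_def)
  qed
  finally show ?thesis .
qed

text \<open>On the one-point space \<open>NJ {}\<close> the density is 1. This gives H(0) = 0 and
  turns conditional inequalities with an empty condition into unconditional ones.\<close>

lemma AE_loglik_empty: "AE \<omega> in M. loglik {} \<omega> = 0"
proof -
  interpret E: prob_space "NJ {}" by (rule prob_spaceI) (simp add: PiM_empty)
  have m: "block X {} \<in> measurable M (NJ {})" by auto
  have "distr M (NJ {}) (block X {}) = density (NJ {}) (\<lambda>_. 1)"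
  proof (rule measure_eqI)
    fix E assume "E \<in> sets (distr M (NJ {}) (block X {}))"
    then have "E = {} \<or> E = {\<lambda>_. undefined}" by (auto simp: PiM_empty)
    then show "emeasure (distr M (NJ {}) (block X {})) E = emeasure (density (NJ {}) (\<lambda>_. 1)) E"
      using m emeasure_space_1
      by (auto simp: emeasure_distr PiM_empty density_1 block_def[abs_def] restrict_def)
  qed simp
  then have "distributed M (NJ {}) (block X {}) (\<lambda>_. 1)" using m by (simp add: distributed_def)
  then have "AE y in NJ {}. 1 = ennreal (dens {} y)" by (intro AE_dens_eq) auto
  then have "AE y in NJ {}. dens {} y = 1" by eventually_elim simp
  from AE_block[OF _ this] show ?thesis by (auto simp: loglik_def elim: eventually_mono)
qed

text \<open>Stationarity compares laws of tuples indexed by the same \<open>J\<close>, whereas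
  \<open>block X K\<close> is indexed by \<open>K\<close>. The maps \<open>S\<close> and
  \<open>T\<close> rename coordinates; \<open>T\<close> carries \<open>NJ J\<close> to
  \<open>NJ K\<close>, so the block \<open>K\<close> has as density that of the block
  \<open>J\<close> composed with \<open>S\<close>.\<close>

lemma ext_entropy_shift:
  fixes k :: nat
  assumes J: "index_set J"
  defines "K \<equiv> (\<lambda>i. i + k) ` J"
  shows "ext_entropy b M (NJ K) (block X K) = ext_entropy b M (NJ J) (block X J)"
proof -
  define S where "S = (\<lambda>y :: nat \<Rightarrow> 'b. \<lambda>i\<in>J. y (i + k))"
  define T where "T = (\<lambda>x :: nat \<Rightarrow> 'b. \<lambda>j\<in>K. x (j - k))"
  have K: "index_set K" using J by (auto simp: K_def)
  have S[measurable]: "S \<in> measurable (NJ K) (NJ J)"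
    unfolding S_def by (intro measurable_restrict measurable_component_singleton) (auto simp: K_def)
  have T[measurable]: "T \<in> measurable (NJ J) (NJ K)"
    unfolding T_def by (intro measurable_restrict measurable_component_singleton) (auto simp: K_def)
  have ST: "S (T x) = x" if "x \<in> space (NJ J)" for x
    using that by (auto simp: S_def T_def K_def fun_eq_iff space_PiM PiE_def extensional_def)
  have T_NJ: "distr (NJ J) (NJ K) T = NJ K"
  proof (rule P.PiM_eqI)
    fix E assume E: "\<And>i. i \<in> K \<Longrightarrow> E i \<in> sets N"
    have "T -` Pi\<^sub>E K E \<inter> space (NJ J) = Pi\<^sub>E J (\<lambda>i. E (i + k))"
      using E[THEN sets.sets_into_space]
      by (auto simp: T_def K_def space_PiM PiE_def Pi_def extensional_def)
    then have "emeasure (distr (NJ J) (NJ K) T) (Pi\<^sub>E K E) = emeasure (NJ J) (Pi\<^sub>E J (\<lambda>i. E (i + k)))"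
      using E K by (subst emeasure_distr) (auto intro!: sets_PiM_I_finite)
    also have "\<dots> = (\<Prod>i\<in>J. emeasure N (E (i + k)))"
      using E J by (intro P.emeasure_PiM) (auto simp: K_def)
    also have "\<dots> = (\<Prod>i\<in>K. emeasure N (E i))"
      unfolding K_def by (subst prod.reindex) auto
    finally show "emeasure (distr (NJ J) (NJ K) T) (Pi\<^sub>E K E) = (\<Prod>i\<in>K. emeasure N (E i))" .
  qed (use K in auto)
  have X: "(\<lambda>\<omega>. \<lambda>i\<in>J. X (i + k) \<omega>) \<in> measurable M (NJ J)"
    using J by (intro measurable_restrict measurable_X) auto
  have "distr M (NJ K) (block X K) = distr M (NJ K) (T \<circ> (\<lambda>\<omega>. \<lambda>i\<in>J. X (i + k) \<omega>))"
    by (intro distr_cong) (auto simp: T_def K_def block_def fun_eq_iff)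
  also have "\<dots> = distr (distr M (NJ J) (\<lambda>\<omega>. \<lambda>i\<in>J. X (i + k) \<omega>)) (NJ K) T"
    using X by (subst distr_distr) auto
  also have "distr M (NJ J) (\<lambda>\<omega>. \<lambda>i\<in>J. X (i + k) \<omega>) = distr M (NJ J) (block X J)"
    using stationary J unfolding stationary_process_def block_def[abs_def] by blast
  also have "\<dots> = density (NJ J) (\<lambda>x. ennreal (dens J x))"
    using distributed_dens[OF J] by (simp add: distributed_def)
  also have "\<dots> = density (NJ J) (\<lambda>x. ennreal (dens J (S (T x))))"
    by (intro density_cong AE_I2) (auto simp: ST)
  also have "distr \<dots> (NJ K) T = density (distr (NJ J) (NJ K) T) (\<lambda>y. ennreal (dens J (S y)))"
    by (rule density_distr[symmetric]) measurable
  also have "\<dots> = density (NJ K) (\<lambda>y. ennreal (dens J (S y)))" by (simp add: T_NJ)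
  finally have d: "distributed M (NJ K) (block X K) (\<lambda>y. ennreal (dens J (S y)))"
    using K by (auto simp: distributed_def)
  let ?f = "\<lambda>y. - (dens J y * log b (dens J y))"
  have "ext_entropy b M (NJ K) (block X K) = ext_integral (NJ K) (\<lambda>y. ?f (S y))"
    by (rule ext_entropy_distributed[OF P.sigma_finite d]) (use K in auto)
  also have "\<dots> = ext_integral (distr (NJ J) (NJ K) T) (\<lambda>y. ?f (S y))" by (simp add: T_NJ)
  also have "\<dots> = ext_integral (NJ J) (\<lambda>x. ?f (S (T x)))"
    by (rule ext_integral_distr) measurable
  also have "\<dots> = ext_integral (NJ J) ?f" by (rule ext_integral_cong) (simp add: ST)
  also have "\<dots> = ext_entropy b M (NJ J) (block X J)"
    by (rule ext_entropy_distributed[OF P.sigma_finite distributed_dens, symmetric]) (use J in auto)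
  finally show ?thesis .
qed

section \<open>Conditional and mutual information\<close>

text \<open>Integrating the ratio against the density of \<open>A \<union> B \<union> C\<close>
  cancels that density. The integral over the coordinates in \<open>A\<close> then turns the density
  of \<open>A \<union> B\<close> into that of \<open>B\<close>, which cancels too, and the density
  of \<open>B \<union> C\<close> has integral 1. Division by 0 gives 0, so zeros of the densities
  can only lower the value.\<close>

lemma nn_integral_cmi_ratio_le_1:
  assumes A: "index_set A" and B: "index_set B" and C: "index_set C"
    and disj: "A \<inter> B = {}" "A \<inter> C = {}" "B \<inter> C = {}"
  shows "(\<integral>\<^sup>+\<omega>. ennreal (W (A \<union> B) \<omega> * W (B \<union> C) \<omega> / (W B \<omega> * W (A \<union> B \<union> C) \<omega>)) \<partial>M) \<le> 1"
proof -
  let ?F = "B \<union> C \<union> A"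
  have F: "A \<union> B \<union> C = ?F" "A \<union> B = B \<union> A" by auto
  interpret A: sigma_finite_measure "NJ A" by (rule P.sigma_finite) (use A in auto)
  have [measurable]: "(\<lambda>y. restrict y (B \<union> C)) \<in> measurable (NJ ?F) (NJ (B \<union> C))"
    "(\<lambda>y. restrict y (B \<union> A)) \<in> measurable (NJ ?F) (NJ (B \<union> A))"
    "(\<lambda>y. restrict y B) \<in> measurable (NJ ?F) (NJ B)"
    "(\<lambda>y. restrict y B) \<in> measurable (NJ (B \<union> C)) (NJ B)"
    by (auto intro!: measurable_restrict_subset)
  define \<phi> where "\<phi> = (\<lambda>y. \<integral>\<^sup>+x. ennreal (dens (B \<union> A) (merge B A (y, x))) \<partial>NJ A)"
  have \<phi>_meas[measurable]: "\<phi> \<in> borel_measurable (NJ B)" unfolding \<phi>_def by measurable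
  have \<phi>: "AE y in NJ B. \<phi> y = ennreal (dens B y)"
    unfolding \<phi>_def using A B disj
    by (intro AE_dens_eq distributed_marginal distributed_dens) auto
  define g where "g = (\<lambda>y. ennreal (dens (B \<union> C) y) * ennreal (1 / dens B (restrict y B)))"
  have [measurable]: "g \<in> borel_measurable (NJ (B \<union> C))" unfolding g_def by measurable
  have "(\<integral>\<^sup>+\<omega>. ennreal (W (A \<union> B) \<omega> * W (B \<union> C) \<omega> / (W B \<omega> * W (A \<union> B \<union> C) \<omega>)) \<partial>M) =
    (\<integral>\<^sup>+\<omega>. (\<lambda>y. ennreal (dens (B \<union> A) (restrict y (B \<union> A)) * dens (B \<union> C) (restrict y (B \<union> C)) /
      (dens B (restrict y B) * dens ?F y))) (block X ?F \<omega>) \<partial>M)"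
    unfolding F(1) unfolding F(2) by (intro nn_integral_cong, subst (1 2 3) restrict_block) auto
  also have "\<dots> = (\<integral>\<^sup>+y. ennreal (dens ?F y) *
      ennreal (dens (B \<union> A) (restrict y (B \<union> A)) * dens (B \<union> C) (restrict y (B \<union> C)) /
      (dens B (restrict y B) * dens ?F y)) \<partial>NJ ?F)"
    by (rule distributed_nn_integral[OF distributed_dens, symmetric]) (use A B C in auto)
  also have "\<dots> \<le> (\<integral>\<^sup>+y. ennreal (dens (B \<union> A) (restrict y (B \<union> A))) * g (restrict y (B \<union> C)) \<partial>NJ ?F)"
  proof (intro nn_integral_mono)
    fix y :: "nat \<Rightarrow> 'b"
    have [simp]: "restrict (restrict y (B \<union> C)) B = restrict y B" by (simp add: Int_absorb1)
    \<comment> \<open>Equality holds unless \<open>dens ?F y = 0\<close>, in which case the left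
      side is 0.\<close>
    show "ennreal (dens ?F y) *
      ennreal (dens (B \<union> A) (restrict y (B \<union> A)) * dens (B \<union> C) (restrict y (B \<union> C)) /
      (dens B (restrict y B) * dens ?F y)) \<le>
      ennreal (dens (B \<union> A) (restrict y (B \<union> A))) * g (restrict y (B \<union> C))"
      unfolding g_def by (cases "dens ?F y = 0") (simp_all flip: ennreal_mult')
  qed
  also have "\<dots> = (\<integral>\<^sup>+y. (\<integral>\<^sup>+x. ennreal (dens (B \<union> A)
      (restrict (merge (B \<union> C) A (y, x)) (B \<union> A))) \<partial>NJ A) * g y \<partial>NJ (B \<union> C))"
    by (rule nn_integral_fold_restrict) (use A B C disj in auto)
  also have "\<dots> = (\<integral>\<^sup>+y. ennreal (dens (B \<union> C) y) *
      (\<phi> (restrict y B) * ennreal (1 / dens B (restrict y B))) \<partial>NJ (B \<union> C))"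
  proof (intro nn_integral_cong)
    fix y :: "nat \<Rightarrow> 'b"
    have "restrict (merge (B \<union> C) A (y, x)) (B \<union> A) = merge B A (restrict y B, x)" for x
      using disj by (auto simp: merge_def fun_eq_iff)
    then show "(\<integral>\<^sup>+x. ennreal (dens (B \<union> A) (restrict (merge (B \<union> C) A (y, x)) (B \<union> A))) \<partial>NJ A) * g y =
      ennreal (dens (B \<union> C) y) * (\<phi> (restrict y B) * ennreal (1 / dens B (restrict y B)))"
      by (simp add: \<phi>_def g_def ac_simps)
  qed
  also have "\<dots> = (\<integral>\<^sup>+\<omega>. (\<lambda>y. \<phi> (restrict y B) * ennreal (1 / dens B (restrict y B))) (block X (B \<union> C) \<omega>) \<partial>M)"
    by (rule distributed_nn_integral[OF distributed_dens]) (use B C in auto)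
  also have "\<dots> = (\<integral>\<^sup>+\<omega>. \<phi> (block X B \<omega>) * ennreal (1 / W B \<omega>) \<partial>M)"
    by (simp add: restrict_block)
  also have "\<dots> \<le> (\<integral>\<^sup>+\<omega>. 1 \<partial>M)"
  proof (rule nn_integral_mono_AE, use AE_block[OF B \<phi>] in eventually_elim)
    fix \<omega> assume "\<phi> (block X B \<omega>) = ennreal (W B \<omega>)"
    then show "\<phi> (block X B \<omega>) * ennreal (1 / W B \<omega>) \<le> 1"
      by (cases "W B \<omega> = 0") (simp_all flip: ennreal_mult')
  qed
  also have "\<dots> = 1" by (simp add: emeasure_space_1)
  finally show ?thesis .
qed

lemma AE_log_cmi_ratio:
  assumes A: "index_set A" and B: "index_set B" and C: "index_set C"
  shows "AE \<omega> in M. 0 < W (A \<union> B) \<omega> * W (B \<union> C) \<omega> / (W B \<omega> * W (A \<union> B \<union> C) \<omega>) \<and>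
    log b (W (A \<union> B) \<omega> * W (B \<union> C) \<omega> / (W B \<omega> * W (A \<union> B \<union> C) \<omega>)) =
    loglik (A \<union> B) \<omega> + loglik (B \<union> C) \<omega> - loglik B \<omega> - loglik (A \<union> B \<union> C) \<omega>"
proof -
  have "AE \<omega> in M. 0 < W (A \<union> B) \<omega>" "AE \<omega> in M. 0 < W (B \<union> C) \<omega>"
    "AE \<omega> in M. 0 < W B \<omega>" "AE \<omega> in M. 0 < W (A \<union> B \<union> C) \<omega>"
    using A B C by (auto intro!: AE_W_pos)
  then show ?thesis
    by eventually_elim (use b in \<open>simp add: loglik_def log_mult log_divide\<close>)
qed

text \<open>The function is minus the conditional information density of \<open>A\<close> and
  \<open>C\<close> given \<open>B\<close>; the entropies involved may be infinite. The integrability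
  results below arise by adding further upper integrable functions until only the wanted term
  remains.\<close>

lemma upper_integrable_cmi:
  assumes A: "index_set A" and B: "index_set B" and C: "index_set C"
    and disj: "A \<inter> B = {}" "A \<inter> C = {}" "B \<inter> C = {}"
  shows "upper_integrable M
    (\<lambda>\<omega>. loglik (A \<union> B) \<omega> + loglik (B \<union> C) \<omega> - loglik B \<omega> - loglik (A \<union> B \<union> C) \<omega>)"
proof -
  have [measurable]: "W (A \<union> B) \<in> borel_measurable M" "W (B \<union> C) \<in> borel_measurable M"
    "W B \<in> borel_measurable M" "W (A \<union> B \<union> C) \<in> borel_measurable M"
    "loglik (A \<union> B) \<in> borel_measurable M" "loglik (B \<union> C) \<in> borel_measurable M"
    "loglik B \<in> borel_measurable M" "loglik (A \<union> B \<union> C) \<in> borel_measurable M"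
    using A B C by auto
  note ratio = AE_log_cmi_ratio[OF A B C]
  show ?thesis
    by (rule upper_integrable_cong_AE[OF upper_integrable_log[OF b _ _ nn_integral_cmi_ratio_le_1[OF assms]]])
       (use ratio in \<open>auto elim: eventually_mono\<close>)
qed

text \<open>Strong subadditivity, H(AB) + H(BC) \<ge> H(B) + H(ABC), with signs reversed because
  entropy is minus the expectation of \<open>loglik\<close>.\<close>

lemma expectation_cmi:
  assumes A: "index_set A" and B: "index_set B" and C: "index_set C"
    and disj: "A \<inter> B = {}" "A \<inter> C = {}" "B \<inter> C = {}"
    and int: "integrable M (loglik (A \<union> B))" "integrable M (loglik (B \<union> C))"
      "integrable M (loglik B)" "integrable M (loglik (A \<union> B \<union> C))"
  shows "expectation (loglik (A \<union> B)) + expectation (loglik (B \<union> C)) \<le>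
    expectation (loglik B) + expectation (loglik (A \<union> B \<union> C))"
proof -
  have [measurable]: "W (A \<union> B) \<in> borel_measurable M" "W (B \<union> C) \<in> borel_measurable M"
    "W B \<in> borel_measurable M" "W (A \<union> B \<union> C) \<in> borel_measurable M"
    using A B C by auto
  let ?v = "\<lambda>\<omega>. W (A \<union> B) \<omega> * W (B \<union> C) \<omega> / (W B \<omega> * W (A \<union> B \<union> C) \<omega>)"
  let ?l = "\<lambda>\<omega>. loglik (A \<union> B) \<omega> + loglik (B \<union> C) \<omega> - loglik B \<omega> - loglik (A \<union> B \<union> C) \<omega>"
  note ratio = AE_log_cmi_ratio[OF A B C]
  have l: "integrable M ?l" using int by simp
  have eq: "AE \<omega> in M. log b (?v \<omega>) = ?l \<omega>" using ratio by (auto elim: eventually_mono)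
  have lv: "integrable M (\<lambda>\<omega>. log b (?v \<omega>))"
    by (rule integrable_cong_AE_imp[OF l]) (use eq in \<open>auto elim: eventually_mono\<close>)
  have "expectation ?l = expectation (\<lambda>\<omega>. log b (?v \<omega>))"
    by (rule integral_cong_AE) (use l eq in \<open>auto elim: eventually_mono\<close>)
  also have "\<dots> \<le> 0"
    by (rule expectation_log_nonpos[OF b _ _ nn_integral_cmi_ratio_le_1[OF A B C disj] lv])
       (use ratio in \<open>auto elim: eventually_mono\<close>)
  finally show ?thesis using int by simp
qed

text \<open>The joint law \<open>R\<close> and the product law \<open>Q\<close> have densities
  \<open>p\<close> and \<open>q\<close> with respect to the same measure \<open>?S\<close>, so
  \<open>R\<close> has density \<open>p / q\<close> with respect to \<open>Q\<close>. Evaluated at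
  the process, its logarithm is the integrand on the right. Infinite values are included.\<close>

lemma ext_mutual_information_eq:
  assumes A: "index_set A" and C: "index_set C" and disj: "A \<inter> C = {}"
  shows "ext_mutual_information b M (NJ A) (NJ C) (block X A) (block X C) =
    ext_integral M (\<lambda>\<omega>. loglik (A \<union> C) \<omega> - loglik A \<omega> - loglik C \<omega>)"
proof -
  let ?PA = "distr M (NJ A) (block X A)" and ?PC = "distr M (NJ C) (block X C)"
  let ?S = "NJ A \<Otimes>\<^sub>M NJ C"
  let ?split = "\<lambda>y. (restrict y A, restrict y C)"
  define Q where "Q = ?PA \<Otimes>\<^sub>M ?PC"
  define R where "R = distr M ?S (\<lambda>\<omega>. (block X A \<omega>, block X C \<omega>))"
  define p where "p = (\<lambda>z. dens (A \<union> C) (merge A C z))"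
  define q where "q = (\<lambda>z. dens A (fst z) * dens C (snd z))"
  have AC: "index_set (A \<union> C)" using A C by auto
  have [measurable]: "block X A \<in> measurable M (NJ A)" "block X C \<in> measurable M (NJ C)"
    "block X (A \<union> C) \<in> measurable M (NJ (A \<union> C))"
    using A C by auto
  have [measurable]: "?split \<in> measurable (NJ (A \<union> C)) ?S"
    by (intro measurable_Pair measurable_restrict_subset) auto
  have [measurable]: "p \<in> borel_measurable ?S" "q \<in> borel_measurable ?S"
    unfolding p_def q_def by measurable
  interpret C: sigma_finite_measure "NJ C" by (rule P.sigma_finite) (use C in auto)
  interpret PA: prob_space ?PA by (rule prob_space_distr) measurable
  interpret PC: prob_space ?PC by (rule prob_space_distr) measurable
  interpret Q: pair_prob_space ?PA ?PC ..
  have lawA: "?PA = density (NJ A) (\<lambda>y. ennreal (dens A y))"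
    and lawC: "?PC = density (NJ C) (\<lambda>y. ennreal (dens C y))"
    and lawAC: "distr M (NJ (A \<union> C)) (block X (A \<union> C)) = density (NJ (A \<union> C)) (\<lambda>y. ennreal (dens (A \<union> C) y))"
    using distributed_dens[OF A] distributed_dens[OF C] distributed_dens[OF AC]
    by (simp_all add: distributed_def)
  have Q_density: "Q = density ?S (\<lambda>z. ennreal (q z))"
  proof -
    have "Q = density ?S (\<lambda>(x, y). ennreal (dens A x) * ennreal (dens C y))"
      unfolding Q_def lawA lawC
      by (rule pair_measure_density) (use C.sigma_finite_measure_axioms PC.sigma_finite_measure_axioms in \<open>simp_all add: lawC\<close>)
    also have "(\<lambda>(x, y). ennreal (dens A x) * ennreal (dens C y)) = (\<lambda>z. ennreal (q z))"
      by (auto simp: q_def ennreal_mult' fun_eq_iff)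
    finally show ?thesis .
  qed
  have R_density: "R = density ?S (\<lambda>z. ennreal (p z))"
  proof -
    \<comment> \<open>\<open>R\<close> is the law of the block \<open>A \<union> C\<close> split
      into its two parts. Splitting undoes \<open>merge\<close>, which carries \<open>?S\<close> to
      the reference measure of \<open>A \<union> C\<close>.\<close>
    have "R = distr (distr M (NJ (A \<union> C)) (block X (A \<union> C))) ?S ?split"
      unfolding R_def by (subst distr_distr) (auto intro!: distr_cong simp: restrict_block)
    also have "\<dots> = distr (density (distr ?S (NJ (A \<union> C)) (merge A C)) (\<lambda>y. ennreal (dens (A \<union> C) y))) ?S ?split"
      unfolding lawAC by (subst P.distr_merge) (use A C disj in auto)
    also have "\<dots> = distr (density ?S (\<lambda>z. ennreal (p z))) ?S (?split \<circ> merge A C)"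
      unfolding p_def by (subst density_distr) (simp_all add: distr_distr)
    also have "\<dots> = distr (density ?S (\<lambda>z. ennreal (p z))) ?S (\<lambda>z. z)"
      using disj by (intro distr_cong)
        (auto simp: space_pair_measure space_PiM PiE_restrict restrict_merge)
    also have "\<dots> = density ?S (\<lambda>z. ennreal (p z))" by (rule distr_id2) simp
    finally show ?thesis .
  qed
  \<comment> \<open>Both marginal densities are almost surely positive along the process, so
    \<open>R\<close> has no mass where \<open>q\<close> vanishes. This is what makes
    \<open>p / q\<close> a density of \<open>R\<close> with respect to \<open>Q\<close>.\<close>
  have q_pos: "AE z in R. 0 < q z"
    unfolding R_def
    by (subst AE_distr_iff) (use AE_W_pos[OF A] AE_W_pos[OF C] in \<open>auto simp: q_def\<close>)
  then have q_pos_S: "AE z in ?S. 0 < p z \<longrightarrow> 0 < q z"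
    unfolding R_density by (subst (asm) AE_density) auto
  have R_Q: "R = density Q (\<lambda>z. ennreal (p z / q z))"
    unfolding Q_density R_density
  proof (subst density_density_eq)
    show "density ?S (\<lambda>z. ennreal (p z)) = density ?S (\<lambda>z. ennreal (q z) * ennreal (p z / q z))"
    proof (intro density_cong)
      show "AE z in ?S. ennreal (p z) = ennreal (q z) * ennreal (p z / q z)"
        using q_pos_S
      proof eventually_elim
        fix z assume "0 < p z \<longrightarrow> 0 < q z"
        moreover have "0 \<le> p z" "0 \<le> q z" by (simp_all add: p_def q_def)
        ultimately show "ennreal (p z) = ennreal (q z) * ennreal (p z / q z)"
          by (cases "p z = 0") (simp_all flip: ennreal_mult')
      qed
    qed auto
  qed auto
  have sets_Q: "sets Q = sets ?S" unfolding Q_def by (rule sets_pair_measure_cong) simp_all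
  have meas_pq: "(\<lambda>z. p z / q z) \<in> borel_measurable ?S" by measurable
  then have meas_pq': "(\<lambda>z. ennreal (p z / q z)) \<in> borel_measurable Q"
    by (simp cong: measurable_cong_sets add: sets_Q)
  have ac: "absolutely_continuous Q R"
    unfolding R_Q by (rule absolutely_continuousI_density) (rule meas_pq')
  have "AE z in Q. ennreal (p z / q z) = RN_deriv Q R z"
    unfolding Q_def
    by (rule Q.RN_deriv_unique) (use meas_pq' R_Q in \<open>simp_all add: Q_def\<close>)
  \<comment> \<open>Uniqueness of the derivative holds almost everywhere for \<open>Q\<close>, hence
    by absolute continuity also for \<open>R\<close>, over which the integral is taken.\<close>
  then have RN: "AE z in R. ennreal (p z / q z) = RN_deriv Q R z"
    by (rule absolutely_continuous_AE[OF _ ac, rotated]) (simp add: R_def sets_Q)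
  have "ext_mutual_information b M (NJ A) (NJ C) (block X A) (block X C) = ext_integral R (entropy_density b Q R)"
    using ac by (simp add: ext_mutual_information_def ext_KL_divergence_def Q_def R_def)
  also have "\<dots> = ext_integral R (\<lambda>z. log b (p z / q z))"
  proof (intro ext_integral_cong_AE, use RN in eventually_elim)
    fix z assume "ennreal (p z / q z) = RN_deriv Q R z"
    moreover have "0 \<le> p z / q z" by (simp add: p_def q_def)
    ultimately show "entropy_density b Q R z = log b (p z / q z)"
      unfolding entropy_density_def by (metis comp_apply enn2real_ennreal)
  qed
  also have "\<dots> = ext_integral M (\<lambda>\<omega>. log b (p (block X A \<omega>, block X C \<omega>) / q (block X A \<omega>, block X C \<omega>)))"
    unfolding R_def by (rule ext_integral_distr) (use meas_pq in measurable)
  also have "\<dots> = ext_integral M (\<lambda>\<omega>. loglik (A \<union> C) \<omega> - loglik A \<omega> - loglik C \<omega>)"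
    using AE_W_pos[OF A] AE_W_pos[OF C] AE_W_pos[OF AC]
    by (intro ext_integral_cong_AE, eventually_elim)
       (use b in \<open>simp add: p_def q_def loglik_def merge_block log_mult log_divide\<close>)
  finally show ?thesis .
qed

section \<open>Entropy and information of prefixes; monotonicity of information\<close>

lemma integrable_loglik_iff:
  assumes "index_set J" "upper_integrable M (\<lambda>\<omega>. - loglik J \<omega>)"
  shows "integrable M (loglik J) \<longleftrightarrow> ext_entropy b M (NJ J) (block X J) \<noteq> -\<infinity>"
  using assms ext_integral_eq_MInf[of M "\<lambda>\<omega>. - loglik J \<omega>"]
    ext_integral_eq_integral[of M "\<lambda>\<omega>. - loglik J \<omega>"]
  by (auto simp: ext_entropy_eq)

text \<open>The case \<open>n = 0\<close>, where \<open>block_entropy\<close> is 0 by convention,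
  fits the formula because \<open>loglik {}\<close> vanishes almost surely.\<close>

lemma block_entropy_eq: "block_entropy b M N X n = ext_integral M (\<lambda>\<omega>. - loglik {1..n} \<omega>)"
proof (cases "n = 0")
  case True
  have "ext_integral M (\<lambda>\<omega>. - loglik {} \<omega>) = ext_integral M (\<lambda>_. 0)"
    using AE_loglik_empty by (intro ext_integral_cong_AE) auto
  with True show ?thesis by (simp add: block_entropy_def ext_integral_def zero_ennreal.rep_eq)
next
  case False
  then show ?thesis by (simp add: block_entropy_def ext_entropy_eq del: One_nat_def)
qed

lemma past_future_information_upto_eq:
  "past_future_information_upto b M N X n =
    ext_integral M (\<lambda>\<omega>. loglik {1..2 * n} \<omega> - loglik {1..n} \<omega> - loglik {n+1..2 * n} \<omega>)"
proof -
  have "{1..n} \<union> {n+1..2 * n} = {1..2 * n}" by auto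
  then show ?thesis
    unfolding past_future_information_upto_def
    by (subst ext_mutual_information_eq) auto
qed

text \<open>The chain rule on integrands: the information density of \<open>A\<close> and
  \<open>C'\<close> is that of \<open>A\<close> and \<open>C\<close> plus the function of
  \<open>upper_integrable_cmi\<close> for \<open>A\<close> and \<open>C - C'\<close> given
  \<open>C'\<close>.\<close>

lemma upper_integrable_information_mono_right:
  assumes A: "index_set A" and C: "index_set C" and "A \<inter> C = {}" and "C' \<subseteq> C"
    and "upper_integrable M (\<lambda>\<omega>. loglik (A \<union> C) \<omega> - loglik A \<omega> - loglik C \<omega>)"
  shows "upper_integrable M (\<lambda>\<omega>. loglik (A \<union> C') \<omega> - loglik A \<omega> - loglik C' \<omega>)"
proof -
  have C': "index_set C'" "index_set (C - C')" using C \<open>C' \<subseteq> C\<close> by (auto intro: finite_subset)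
  have eq: "C' \<union> (C - C') = C" "A \<union> C' \<union> (C - C') = A \<union> C" using \<open>C' \<subseteq> C\<close> by auto
  have "upper_integrable M (\<lambda>\<omega>. loglik (A \<union> C') \<omega> + loglik C \<omega> - loglik C' \<omega> - loglik (A \<union> C) \<omega>)"
    using upper_integrable_cmi[OF A C'] assms(3,4) unfolding eq by blast
  from upper_integrable_add[OF this assms(5)] show ?thesis by (simp add: algebra_simps)
qed

lemma upper_integrable_information_mono:
  assumes A: "index_set A" and C: "index_set C" and "A \<inter> C = {}" and "A' \<subseteq> A" "C' \<subseteq> C"
    and "upper_integrable M (\<lambda>\<omega>. loglik (A \<union> C) \<omega> - loglik A \<omega> - loglik C \<omega>)"
  shows "upper_integrable M (\<lambda>\<omega>. loglik (A' \<union> C') \<omega> - loglik A' \<omega> - loglik C' \<omega>)"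
proof -
  have C': "index_set C'" using C \<open>C' \<subseteq> C\<close> by (auto intro: finite_subset)
  have "upper_integrable M (\<lambda>\<omega>. loglik (A \<union> C') \<omega> - loglik A \<omega> - loglik C' \<omega>)"
    by (rule upper_integrable_information_mono_right) fact+
  then have "upper_integrable M (\<lambda>\<omega>. loglik (C' \<union> A) \<omega> - loglik C' \<omega> - loglik A \<omega>)"
    by (simp add: algebra_simps Un_commute)
  from upper_integrable_information_mono_right[OF C' A _ \<open>A' \<subseteq> A\<close> this] assms(3,5)
  have "upper_integrable M (\<lambda>\<omega>. loglik (C' \<union> A') \<omega> - loglik C' \<omega> - loglik A' \<omega>)" by blast
  then show ?thesis by (simp add: algebra_simps Un_commute)
qed

end

section \<open>Processes of finite entropy\<close>

locale finite_entropy_process = density_process +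
  assumes finite_entropy: "\<bar>block_entropy b M N X 1\<bar> \<noteq> \<infinity>"
begin

section \<open>Integrability of log likelihoods\<close>

lemma integrable_loglik_singleton:
  assumes "i \<ge> 1" shows "integrable M (loglik {i})"
proof -
  have "ext_entropy b M (NJ {i}) (block X {i}) = ext_entropy b M (NJ {1}) (block X {1})"
    using ext_entropy_shift[of "{1}" "i - 1"] assms by simp
  moreover have "\<bar>ext_entropy b M (NJ {1}) (block X {1})\<bar> \<noteq> \<infinity>"
    using finite_entropy by (simp add: block_entropy_def)
  ultimately have "\<bar>ext_integral M (\<lambda>\<omega>. - loglik {i} \<omega>)\<bar> \<noteq> \<infinity>"
    using assms by (simp flip: ext_entropy_eq)
  then have "integrable M (\<lambda>\<omega>. - loglik {i} \<omega>)"
    using assms by (intro ext_integral_finite_imp_integrable) auto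
  then show ?thesis by simp
qed

text \<open>By subadditivity, adding one variable raises the entropy by at most the finite entropy
  of that variable; so no block has entropy \<infinity>.\<close>

lemma upper_integrable_neg_loglik:
  assumes "index_set J" shows "upper_integrable M (\<lambda>\<omega>. - loglik J \<omega>)"
proof -
  have "finite J" "J \<subseteq> {1..}" using assms by auto
  then show ?thesis
  proof (induction J rule: finite_induct)
    case empty
    show ?case
      by (rule upper_integrable_cong_AE[where f = "\<lambda>_. 0"])
         (use AE_loglik_empty in \<open>auto simp: upper_integrable_def\<close>)
  next
    case (insert i J)
    have J: "index_set J" and i: "index_set {i}" using insert by auto
    have "upper_integrable M (\<lambda>\<omega>. loglik (J \<union> {}) \<omega> + loglik ({} \<union> {i}) \<omega> - loglik {} \<omega> - loglik (J \<union> {} \<union> {i}) \<omega>)"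
      using insert by (intro upper_integrable_cmi) auto
    moreover have "upper_integrable M (\<lambda>\<omega>. - loglik J \<omega>)" using insert by simp
    moreover have "upper_integrable M (\<lambda>\<omega>. - loglik {i} \<omega>)"
      using integrable_loglik_singleton[of i] i by (simp add: integrable_iff_upper_integrable)
    ultimately have "upper_integrable M (\<lambda>\<omega>. loglik (J \<union> {}) \<omega> + loglik ({} \<union> {i}) \<omega> - loglik {} \<omega>
        - loglik (J \<union> {} \<union> {i}) \<omega> + - loglik J \<omega> + - loglik {i} \<omega>)"
      by (intro upper_integrable_add)
    then show ?case
      by (rule upper_integrable_cong_AE) (use AE_loglik_empty insert in \<open>auto elim: eventually_mono\<close>)
  qed
qed

text \<open>From H(K) \<le> H(J) + H(K - J) and H(K - J) < \<infinity>, a finite H(K) excludes H(J)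
  = -\<infinity>. Hence a prefix of entropy -\<infinity> forces this value on all longer
  prefixes.\<close>

lemma integrable_loglik_mono:
  assumes K: "index_set K" and "J \<subseteq> K" and int: "integrable M (loglik K)"
  shows "integrable M (loglik J)"
proof -
  let ?C = "K - J"
  have J: "index_set J" and C: "index_set ?C" using K \<open>J \<subseteq> K\<close> by (auto intro: finite_subset)
  have eq: "J \<union> ?C = K" using \<open>J \<subseteq> K\<close> by auto
  have "upper_integrable M (\<lambda>\<omega>. loglik (J \<union> {}) \<omega> + loglik ({} \<union> ?C) \<omega> - loglik {} \<omega> - loglik (J \<union> {} \<union> ?C) \<omega>)"
    using J C by (intro upper_integrable_cmi) auto
  moreover have "upper_integrable M (\<lambda>\<omega>. - loglik ?C \<omega>)" using C by (rule upper_integrable_neg_loglik)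
  moreover have "upper_integrable M (loglik K)"
    using int by (simp add: integrable_iff_upper_integrable)
  ultimately have "upper_integrable M (\<lambda>\<omega>. loglik (J \<union> {}) \<omega> + loglik ({} \<union> ?C) \<omega> - loglik {} \<omega>
      - loglik (J \<union> {} \<union> ?C) \<omega> + - loglik ?C \<omega> + loglik K \<omega>)"
    by (intro upper_integrable_add)
  then have "upper_integrable M (loglik J)"
    by (rule upper_integrable_cong_AE) (use AE_loglik_empty J \<open>J \<subseteq> K\<close> in \<open>auto simp: Un_absorb1 elim: eventually_mono\<close>)
  then show ?thesis
    using upper_integrable_neg_loglik[OF J] by (simp add: integrable_iff_upper_integrable)
qed

lemma integrable_loglik_shift:
  assumes J: "index_set J"
  shows "integrable M (loglik ((\<lambda>i. i + k) ` J)) \<longleftrightarrow> integrable M (loglik J)"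
proof -
  have "index_set ((\<lambda>i. i + k) ` J)" using J by auto
  then show ?thesis
    using J by (simp add: integrable_loglik_iff upper_integrable_neg_loglik ext_entropy_shift)
qed

lemma expectation_loglik_shift:
  assumes J: "index_set J" and int: "integrable M (loglik J)"
  shows "expectation (loglik ((\<lambda>i. i + k) ` J)) = expectation (loglik J)"
proof -
  have K: "index_set ((\<lambda>i. i + k) ` J)" using J by auto
  have "integrable M (loglik ((\<lambda>i. i + k) ` J))"
    using integrable_loglik_shift[OF J] int by simp
  with J K int ext_entropy_shift[OF J, of k] show ?thesis
    by (simp add: ext_entropy_eq ext_integral_eq_integral)
qed

section \<open>The two cases: all prefix entropies finite, or one of them infinite\<close>

lemma excess_entropy_finite:
  assumes int: "\<And>n. integrable M (loglik {1..n})"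
  shows "excess_entropy b M N X = past_future_information b M N X"
proof -
  define a where "a n = - expectation (loglik {1..n})" for n
  have shift: "integrable M (loglik {1 + k..n + k}) \<and> expectation (loglik {1 + k..n + k}) = - a n" for k n
    using integrable_loglik_shift[of "{1..n}" k] expectation_loglik_shift[of "{1..n}" k] int[of n]
    by (auto simp: a_def image_add_atLeastAtMost' simp del: One_nat_def)
  have H: "block_entropy b M N X n = ereal (a n)" for n
    unfolding block_entropy_eq a_def using int[of n] by (simp add: ext_integral_eq_integral)
  interpret a: concave_sequence a
  proof
    show "a 0 = 0"
      using H[of 0] by (simp add: block_entropy_def zero_ereal_def)
    fix n
    \<comment> \<open>Concavity is strong subadditivity for \<open>{1}\<close>,
      \<open>{2..n + 1}\<close> and \<open>{n + 2}\<close>. By stationarity the two overlapping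
      blocks of length \<open>n + 1\<close> have the same entropy, and the middle block has entropy
      \<open>a n\<close>.\<close>
    have eq: "{1} \<union> {2..n + 1} = {1..Suc n}" "{2..n + 1} \<union> {n + 2} = {1 + 1..Suc n + 1}"
      "{1} \<union> {2..n + 1} \<union> {n + 2} = {1..Suc (Suc n)}" "{2..n + 1} = {1 + 1..n + 1}" by auto
    have "expectation (loglik ({1} \<union> {2..n + 1})) + expectation (loglik ({2..n + 1} \<union> {n + 2})) \<le>
      expectation (loglik {2..n + 1}) + expectation (loglik ({1} \<union> {2..n + 1} \<union> {n + 2}))"
    proof (rule expectation_cmi)
      show "integrable M (loglik ({1} \<union> {2..n + 1}))" "integrable M (loglik ({1} \<union> {2..n + 1} \<union> {n + 2}))"
        unfolding eq(3) unfolding eq(1) by (rule int)+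
      show "integrable M (loglik ({2..n + 1} \<union> {n + 2}))"
        unfolding eq(2) using shift by blast
      show "integrable M (loglik {2..n + 1})"
        unfolding eq(4) using shift by blast
    qed auto
    moreover have "expectation (loglik ({1} \<union> {2..n + 1})) = - a (Suc n)"
      "expectation (loglik ({1} \<union> {2..n + 1} \<union> {n + 2})) = - a (Suc (Suc n))"
      unfolding eq(3) unfolding eq(1) a_def by simp_all
    moreover have "expectation (loglik ({2..n + 1} \<union> {n + 2})) = - a (Suc n)"
      unfolding eq(2) using shift by blast
    moreover have "expectation (loglik {2..n + 1}) = - a n"
      unfolding eq(4) using shift by blast
    ultimately show "a (Suc (Suc n)) + a n \<le> 2 * a (Suc n)" by simp
  qed
  have rate: "entropy_rate b M N X = a.h_lim"
    unfolding entropy_rate_def H by (rule limI) (rule a.tendsto_average)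
  have E: "excess_entropy b M N X = (\<Sum>n. ereal (a.h n) - a.h_lim)"
    unfolding excess_entropy_def entropy_gain_def H rate by (simp add: a.h_def)
  have I: "past_future_information_upto b M N X n = ereal (2 * a n - a (2 * n))" for n
  proof -
    \<comment> \<open>The future is the past shifted by \<open>n\<close>, so both have entropy
      \<open>a n\<close>.\<close>
    have "{n+1..2 * n} = {1 + n..n + n}" by auto
    then have "integrable M (loglik {n+1..2 * n})" "expectation (loglik {n+1..2 * n}) = - a n"
      using shift[of n n] by metis+
    then show ?thesis
      unfolding past_future_information_upto_eq using int[of n] int[of "2 * n"]
      by (simp add: ext_integral_eq_integral a_def del: One_nat_def)
  qed
  show ?thesis
    unfolding past_future_information_def E
    by (rule limI[symmetric]) (use a.tendsto_excess in \<open>simp add: I[abs_def]\<close>)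
qed

lemma excess_entropy_infinite:
  assumes not_int: "\<not> integrable M (loglik {1..n})"
  shows "excess_entropy b M N X = \<infinity>" "past_future_information b M N X = \<infinity>"
proof -
  define m where "m = (LEAST n. \<not> integrable M (loglik {1..n}))"
  have m: "\<not> integrable M (loglik {1..m})"
    unfolding m_def using not_int by (rule LeastI)
  have less: "integrable M (loglik {1..k})" if "k < m" for k
    using not_less_Least that unfolding m_def by blast
  have m2: "m \<ge> 2"
  proof (rule ccontr)
    assume "\<not> m \<ge> 2"
    then have "{1..m} \<subseteq> {1}" by auto
    from integrable_loglik_mono[OF _ this] integrable_loglik_singleton[of 1] m show False by simp
  qed
  have H: "block_entropy b M N X k = -\<infinity>" if "k \<ge> m" for k
  proof -
    have "\<not> integrable M (loglik {1..k})"
      using m integrable_loglik_mono[of "{1..k}" "{1..m}"] that by auto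
    then show ?thesis
      unfolding block_entropy_eq
      by (intro ext_integral_eq_MInf upper_integrable_neg_loglik) auto
  qed
  have rate: "entropy_rate b M N X = -\<infinity>"
    unfolding entropy_rate_def
  proof (rule limI, rule tendsto_eventually)
    show "\<forall>\<^sub>F n in sequentially. block_entropy b M N X n / ereal (real n) = -\<infinity>"
      using eventually_ge_at_top[of m] by eventually_elim (use m2 H in \<open>simp add: divide_ereal_def\<close>)
  qed
  have "excess_entropy b M N X = (\<Sum>n. \<infinity>)"
    unfolding excess_entropy_def rate by simp
  also have "\<dots> = (SUP n::nat. \<Sum>k<n. \<infinity>)"
    by (subst suminf_ereal_eq_SUP) auto
  also have "\<dots> = \<infinity>"
    by (intro antisym SUP_upper2[of 1]) auto
  finally show "excess_entropy b M N X = \<infinity>" .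
  have I: "past_future_information_upto b M N X k = \<infinity>" if "k \<ge> m" for k
    unfolding past_future_information_upto_eq
  proof (rule ext_integral_eq_PInf)
    show "(\<lambda>\<omega>. loglik {1..2 * k} \<omega> - loglik {1..k} \<omega> - loglik {k+1..2 * k} \<omega>) \<in> borel_measurable M"
      by (intro borel_measurable_diff measurable_loglik) auto
    \<comment> \<open>The shift by \<open>d\<close> moves \<open>{1..m}\<close> to the block that
      ends at \<open>k + 1\<close>, the first future index; \<open>?A\<close> consists of the last
      \<open>m - 1\<close> past indices.\<close>
    define d where "d = k + 1 - m"
    let ?A = "{1 + d..m - 1 + d}"
    have eq: "{1..k} \<union> {k+1..2 * k} = {1..2 * k}" "?A \<union> {k + 1} = {1 + d..m + d}"
      using that m2 by (auto simp: d_def)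
    show "\<not> upper_integrable M (\<lambda>\<omega>. loglik {1..2 * k} \<omega> - loglik {1..k} \<omega> - loglik {k+1..2 * k} \<omega>)"
    proof
      assume up: "upper_integrable M (\<lambda>\<omega>. loglik {1..2 * k} \<omega> - loglik {1..k} \<omega> - loglik {k+1..2 * k} \<omega>)"
      have "upper_integrable M (\<lambda>\<omega>. loglik (?A \<union> {k + 1}) \<omega> - loglik ?A \<omega> - loglik {k + 1} \<omega>)"
      proof (rule upper_integrable_information_mono)
        show "upper_integrable M (\<lambda>\<omega>. loglik ({1..k} \<union> {k+1..2 * k}) \<omega> - loglik {1..k} \<omega> - loglik {k+1..2 * k} \<omega>)"
          unfolding eq by (rule up)
      qed (use that m2 in \<open>auto simp: d_def\<close>)
      \<comment> \<open>\<open>?A\<close> has length \<open>m - 1\<close>, so minimality of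
        \<open>m\<close> makes its log likelihood integrable, as is that of the single variable.
        Adding both back would make the log likelihood of a block of length \<open>m\<close>
        integrable, a contradiction.\<close>
      moreover have "integrable M (loglik ?A)"
        using integrable_loglik_shift[of "{1..m - 1}" d] less[of "m - 1"] m2
        by (simp add: image_add_atLeastAtMost' del: One_nat_def)
      then have "upper_integrable M (loglik ?A)" by (simp add: integrable_iff_upper_integrable)
      moreover have "upper_integrable M (loglik {k + 1})"
        using integrable_loglik_singleton[of "k + 1"] by (simp add: integrable_iff_upper_integrable)
      ultimately have "upper_integrable M (\<lambda>\<omega>. loglik (?A \<union> {k + 1}) \<omega> - loglik ?A \<omega> - loglik {k + 1} \<omega>
          + loglik ?A \<omega> + loglik {k + 1} \<omega>)"
        by (intro upper_integrable_add)
      then have "upper_integrable M (loglik {1 + d..m + d})" unfolding eq by simp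
      then have "integrable M (loglik {1 + d..m + d})"
        by (simp add: integrable_iff_upper_integrable upper_integrable_neg_loglik)
      with m integrable_loglik_shift[of "{1..m}" d] show False
        by (simp add: image_add_atLeastAtMost' del: One_nat_def)
    qed
  qed
  have "past_future_information_upto b M N X \<longlonglongrightarrow> \<infinity>"
    by (rule tendsto_eventually, rule eventually_mono[OF eventually_ge_at_top I])
  then show "past_future_information b M N X = \<infinity>"
    unfolding past_future_information_def by (rule limI)
qed

theorem excess_entropy_eq: "excess_entropy b M N X = past_future_information b M N X"
  using excess_entropy_finite excess_entropy_infinite by metis

end

text \<open>Only the empty set is null for a counting measure, so every law is absolutely
  continuous; countability of \<open>A\<close> gives the sigma-finiteness for the Radon-Nikodym
  theorem.\<close>

lemma distributed_discrete:
  assumes "prob_space M" "countable A" "finite J" and X: "\<And>i. i \<in> J \<Longrightarrow> X i \<in> measurable M (count_space A)"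
  shows "\<exists>f. distributed M (PiM J (\<lambda>_. count_space A)) (block X J) f"
proof -
  interpret prob_space M by fact
  let ?S = "PiM J (\<lambda>_. count_space A)"
  have S: "?S = count_space (PiE J (\<lambda>_. A))"
    by (rule count_space_PiM_finite) (use assms in auto)
  have cnt: "countable (PiE J (\<lambda>_. A))" by (intro countable_PiE) (use assms in auto)
  interpret S: sigma_finite_measure ?S
    unfolding S using cnt by (rule sigma_finite_measure_count_space_countable)
  have meas: "block X J \<in> measurable M ?S"
    unfolding block_def[abs_def] by (intro measurable_restrict X)
  have "absolutely_continuous ?S (distr M ?S (block X J))"
    unfolding absolutely_continuous_def S null_sets_count_space by auto
  then have "density ?S (RN_deriv ?S (distr M ?S (block X J))) = distr M ?S (block X J)"
    by (rule S.density_RN_deriv) simp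
  with meas have "distributed M ?S (block X J) (RN_deriv ?S (distr M ?S (block X J)))"
    by (simp add: distributed_def)
  then show ?thesis by blast
qed

section \<open>The discrete and the continuous case\<close>

theorem theorem2p2:
  fixes b :: real
    and M :: "'a measure" and X :: "nat \<Rightarrow> 'a \<Rightarrow> 's" and A :: "'s set"
    and M' :: "'c measure" and Y :: "nat \<Rightarrow> 'c \<Rightarrow> real"
  assumes "b > 1"
  shows
    "(countable A \<and>
      stationary_process M (count_space A) X \<and>
      \<bar>block_entropy b M (count_space A) X 1\<bar> \<noteq> \<infinity>
      \<longrightarrow> excess_entropy b M (count_space A) X = past_future_information b M (count_space A) X)
     \<and>
     (stationary_process M' lborel Y \<and>
      (\<forall>n\<ge>1. \<exists>f. distributed M' (PiM {1..n} (\<lambda>_. lborel)) (block Y {1..n}) f) \<and>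
      \<bar>block_entropy b M' lborel Y 1\<bar> \<noteq> \<infinity>
      \<longrightarrow> excess_entropy b M' lborel Y = past_future_information b M' lborel Y)"
proof (intro conjI impI; elim conjE)
  assume A: "countable A" and X: "stationary_process M (count_space A) X"
    and H: "\<bar>block_entropy b M (count_space A) X 1\<bar> \<noteq> \<infinity>"
  have M: "prob_space M" using X unfolding stationary_process_def by blast
  have "\<exists>f. distributed M (PiM {1..n} (\<lambda>_. count_space A)) (block X {1..n}) f" for n
    by (rule distributed_discrete[OF M A]) (use X in \<open>unfold stationary_process_def, auto\<close>)
  then interpret finite_entropy_process M "count_space A" X b
    using M A X H assms sigma_finite_measure_count_space_countable
    by (intro finite_entropy_process.intro density_process.intro density_process_axioms.intro
      finite_entropy_process_axioms.intro) blast+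
  show "excess_entropy b M (count_space A) X = past_future_information b M (count_space A) X"
    by (rule excess_entropy_eq)
next
  assume Y: "stationary_process M' lborel Y"
    and f: "\<forall>n\<ge>1. \<exists>f. distributed M' (PiM {1..n} (\<lambda>_. lborel)) (block Y {1..n}) f"
    and H: "\<bar>block_entropy b M' lborel Y 1\<bar> \<noteq> \<infinity>"
  have M: "prob_space M'" using Y unfolding stationary_process_def by blast
  interpret finite_entropy_process M' lborel Y b
    using M Y H assms f sigma_finite_lborel
    by (intro finite_entropy_process.intro density_process.intro density_process_axioms.intro
      finite_entropy_process_axioms.intro) blast+
  show "excess_entropy b M' lborel Y = past_future_information b M' lborel Y"
    by (rule excess_entropy_eq)
qed

end
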